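(* Let $(G,\mathfrak{A})$ be an averaging group with identity element $e$ such that $\mathfrak{A}(e)=e$. Define a binary operation on $G$ by $$g\vartriangleright h:=\mathfrak{A}(g)\,h\,\mathfrak{A}(g)^{-1}\qquad (g,h\in G).$$ Then $$f\vartriangleright(g\vartriangleright h)=(f\vartriangleright g)\vartriangleright(f\vartriangleright h)\quad\text{for all } f,g,h\in G,$$ and for every $g\in G$ the map $L_g:G\to G$, $h\mapsto g\vartriangleright h$, is a bijection. (That is, $(G,\vartriangleright)$ is a rack.)
   Context: An averaging group is a pair $(G,\mathfrak{A})$ where $G$ is a group and $\mathfrak{A}:G\to G$ is a map (not necessarily a homomorphism), called an averaging operator, such that $\mathfrak{A}(g)\mathfrak{A}(h)=\mathfrak{A}(\mathfrak{A}(g)h)=\mathfrak{A}(g\mathfrak{A}(h))$ for all $g,h\in G$. *)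

theory Defs
  imports "HOL-Algebra.Group"
begin

locale averaging_group = group G for G (structure) +
  fixes A :: "'a \<Rightarrow> 'a"
  assumes avg_closed: "A \<in> carrier G \<rightarrow> carrier G"
    and avg_left: "\<lbrakk>g \<in> carrier G; h \<in> carrier G\<rbrakk> \<Longrightarrow> A g \<otimes> A h = A (A g \<otimes> h)"
    and avg_right: "\<lbrakk>g \<in> carrier G; h \<in> carrier G\<rbrakk> \<Longrightarrow> A g \<otimes> A h = A (g \<otimes> A h)"

definition avg_rack_op :: "('a, 'b) monoid_scheme \<Rightarrow> ('a \<Rightarrow> 'a) \<Rightarrow> 'a \<Rightarrow> 'a \<Rightarrow> 'a" where
  "avg_rack_op G A g h = A g \<otimes>\<^bsub>G\<^esub> h \<otimes>\<^bsub>G\<^esub> inv\<^bsub>G\<^esub> (A g)"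

end

theory Submission
  imports Defs
begin

text \<open>
  Conjugation by a fixed group element is an automorphism of the group, so each left translation
  \<open>L\<^sub>g\<close> is bijective.  Self-distributivity amounts to the identity
  \<open>A (f \<rhd> g) = A f \<otimes> A g \<otimes> inv (A f)\<close>: with it, both sides of the law become the conjugate of
  \<open>h\<close> by \<open>A f \<otimes> A g\<close>.  To obtain the identity one pulls the two outer factors of
  \<open>A f \<otimes> g \<otimes> inv (A f)\<close> out of \<open>A\<close>.  The averaging axioms allow this for factors in the
  image of \<open>A\<close>, so the point is that \<open>inv (A f)\<close> also lies in that image.  This is where
  \<open>A \<one> = \<one>\<close> enters: it makes \<open>inv (A f)\<close> a fixed point of \<open>A\<close>.
\<close>

context averaging_group
begin

lemma avg_in_carrier [simp, intro]: "g \<in> carrier G \<Longrightarrow> A g \<in> carrier G"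
  using avg_closed by auto

text \<open>
  Pulling \<open>A f\<close> out of \<open>A (A f \<otimes> inv (A f)) = A \<one> = \<one>\<close> exhibits \<open>A (inv (A f))\<close> as a right
  inverse of \<open>A f\<close>.
\<close>

lemma avg_inv_avg:
  assumes unit: "A \<one> = \<one>" and f: "f \<in> carrier G"
  shows "A (inv (A f)) = inv (A f)"
proof -
  have "A f \<otimes> A (inv (A f)) = A (A f \<otimes> inv (A f))"
    using f by (simp add: avg_left)
  also have "\<dots> = \<one>"
    using f unit by simp
  finally have "A f \<otimes> A (inv (A f)) = \<one>" .
  then have "A (inv (A f)) \<otimes> A f = \<one>"
    by (rule inv_comm) (use f in auto)
  then show ?thesis
    using inv_equality[of "A (inv (A f))" "A f"] f by auto
qed

lemma avg_conjugate:
  assumes unit: "A \<one> = \<one>" and f: "f \<in> carrier G" and g: "g \<in> carrier G"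
  shows "A (A f \<otimes> g \<otimes> inv (A f)) = A f \<otimes> A g \<otimes> inv (A f)"
proof -
  have "A (A f \<otimes> g \<otimes> inv (A f)) = A (A f \<otimes> (g \<otimes> inv (A f)))"
    using f g by (simp add: m_assoc)
  also have "\<dots> = A f \<otimes> A (g \<otimes> inv (A f))"
    using f g by (simp add: avg_left)
  also have "A (g \<otimes> inv (A f)) = A g \<otimes> inv (A f)"
    using avg_right[OF g, of "inv (A f)"] f avg_inv_avg[OF unit f] by simp
  finally show ?thesis
    using f g by (simp add: m_assoc)
qed

lemma avg_rack_op_self_distrib:
  assumes unit: "A \<one> = \<one>"
    and f: "f \<in> carrier G" and g: "g \<in> carrier G" and h: "h \<in> carrier G"
  shows "avg_rack_op G A f (avg_rack_op G A g h)
           = avg_rack_op G A (avg_rack_op G A f g) (avg_rack_op G A f h)"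
proof -
  have cancel: "inv x \<otimes> (x \<otimes> y) = y" if "x \<in> carrier G" "y \<in> carrier G" for x y
    using that by (simp add: m_assoc[symmetric])
  show ?thesis
    unfolding avg_rack_op_def avg_conjugate[OF unit f g]
    using f g h by (simp add: inv_mult_group m_assoc cancel)
qed

end

lemma (in group) bij_betw_conjugation:
  assumes x: "x \<in> carrier G"
  shows "bij_betw (\<lambda>h. x \<otimes> h \<otimes> inv x) (carrier G) (carrier G)"
proof (rule bij_betw_byWitness[where f' = "\<lambda>h. inv x \<otimes> h \<otimes> x"])
  have cancel: "inv x \<otimes> (x \<otimes> y) = y" "x \<otimes> (inv x \<otimes> y) = y" if "y \<in> carrier G" for y
    using that x by (simp_all add: m_assoc[symmetric])
  show "\<forall>h\<in>carrier G. inv x \<otimes> (x \<otimes> h \<otimes> inv x) \<otimes> x = h"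
    and "\<forall>h\<in>carrier G. x \<otimes> (inv x \<otimes> h \<otimes> x) \<otimes> inv x = h"
    using x by (simp_all add: m_assoc cancel)
qed (use x in auto)

theorem proposition3p9:
  fixes G :: "('a, 'b) monoid_scheme" and A :: "'a \<Rightarrow> 'a"
  assumes "averaging_group G A"
    and "A \<one>\<^bsub>G\<^esub> = \<one>\<^bsub>G\<^esub>"
  shows "(\<forall>f\<in>carrier G. \<forall>g\<in>carrier G. \<forall>h\<in>carrier G.
            avg_rack_op G A f (avg_rack_op G A g h)
              = avg_rack_op G A (avg_rack_op G A f g) (avg_rack_op G A f h))
       \<and> (\<forall>g\<in>carrier G. bij_betw (\<lambda>h. avg_rack_op G A g h) (carrier G) (carrier G))"
proof -
  interpret averaging_group G A by fact
  show ?thesis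
  proof (intro conjI ballI)
    show "bij_betw (\<lambda>h. avg_rack_op G A g h) (carrier G) (carrier G)" if "g \<in> carrier G" for g
      unfolding avg_rack_op_def using that by (intro bij_betw_conjugation) auto
  qed (rule avg_rack_op_self_distrib[OF assms(2)])
qed

end
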